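(* Let $\Phi\in\mathbb{R}^{n\times m}$, $y\in\mathbb{R}^n$, $\lambda_0\ge0$, $\lambda_1\ge0$, and let $I_1\subseteq\{1,\dots,m\}$ be a subset of indices. After permuting columns write $\Phi=[\Phi_1\ \Phi_2]$, where $\Phi_1$ consists of the columns of $\Phi$ with indices from $I_1$. Then $I_1$ is a concurrent optimal subset of (P0) and (P1) if and only if both of the following hold: (i) the value $$y^Ty-y^T\Phi_1(\Phi_1^T\Phi_1)^{-1}\Phi_1^Ty+\lambda_0\cdot\|x_1\|_0$$ is the minimum of the objective in (P0), where $x_1=(\Phi_1^T\Phi_1)^{-1}\Phi_1^Ty$ has all entries nonzero (so $\|x_1\|_0=|I_1|$); (ii) there exist a vector $x_1$ indexed by $I_1$ with all entries nonzero and a vector $\omega$ such that $$\Phi^Ty=\begin{pmatrix}\Phi_1^T\Phi_1\\ \Phi_2^T\Phi_1\end{pmatrix}x_1+\begin{pmatrix}\frac{\lambda_1}{2}\cdot\mathrm{sign}(x_1)\\ \omega\end{pmatrix}$$ holds and $\|\omega\|_\infty\le\lambda_1/2$. Moreover, in this case, with $\widetilde{x}_0$ and $\widetilde{x}_1$ the solutions of (P0) and (P1), respectively (having support $I_1$), we have $$(\widetilde{x}_0-\widetilde{x}_1)_{I_1}=(\Phi_1^T\Phi_1)^{-1}\cdot\frac{\lambda_1}{2}\cdot\mathrm{sign}\big((\widetilde{x}_1)_{I_1}\big).$$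
   Context: Setting: $n>m$. Problem (P0): $\min_{x\in\mathbb{R}^m}\|y-\Phi x\|_2^2+\lambda_0\|x\|_0$, where $\|x\|_0$ is the number of nonzero entries of $x$. Problem (P1): $\min_{x\in\mathbb{R}^m}\|y-\Phi x\|_2^2+\lambda_1\|x\|_1$, where $\|x\|_1=\sum_{i=1}^m|x_i|$. A subset of $\{1,\dots,m\}$ that is the support (set of indices of nonzero entries) of a minimizer of (P0) (respectively (P1)) is called a type-0 (respectively type-1) optimal subset with respect to $\lambda_0$ (respectively $\lambda_1$). A subset that is both type-0 and type-1 optimal is called a concurrent optimal subset. For a vector $x\in\mathbb{R}^m$, $(x)_{I_1}$ denotes the vector of entries of $x$ with indices from $I_1$; $\mathrm{sign}$ is applied entrywise. The matrix $\Phi_1^T\Phi_1$ is assumed invertible. *)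

theory Defs
  imports
    "Jordan_Normal_Form.Gauss_Jordan_Elimination"
    "Jordan_Normal_Form.DL_Submatrix"
    "HOL-Analysis.L2_Norm"
begin

(* Vectors and matrices have explicit dimensions, and indices start at 0: the
   index set {1,...,m} is rendered as {..<m}. *)

definition supp_vec :: "real vec \<Rightarrow> nat set" where
  "supp_vec x = {i. i < dim_vec x \<and> x $ i \<noteq> 0}"

definition l0_norm_vec :: "real vec \<Rightarrow> nat" where
  "l0_norm_vec x = card (supp_vec x)"

definition l1_norm_vec :: "real vec \<Rightarrow> real" where
  "l1_norm_vec x = (\<Sum>i<dim_vec x. \<bar>x $ i\<bar>)"

definition l2_norm_vec :: "real vec \<Rightarrow> real" where
  "l2_norm_vec x = L2_set (\<lambda>i. x $ i) {..<dim_vec x}"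

(* Inserting 0 makes the norm of the vector of dimension 0 equal to 0 and
   changes nothing in positive dimension. *)
definition linf_norm_vec :: "real vec \<Rightarrow> real" where
  "linf_norm_vec x = Max (insert 0 {\<bar>x $ i\<bar> | i. i < dim_vec x})"

definition nowhere_zero_vec :: "real vec \<Rightarrow> bool" where
  "nowhere_zero_vec x \<longleftrightarrow> (\<forall>i < dim_vec x. x $ i \<noteq> 0)"

(* The entries with indices from I, in increasing order of the index; this is
   the order in which submatrix arranges columns. *)
definition subvec :: "'a vec \<Rightarrow> nat set \<Rightarrow> 'a vec" where
  "subvec x I = vec (card {i. i < dim_vec x \<and> i \<in> I}) (\<lambda>i. x $ pick I i)"

definition append_cols :: "'a::zero mat \<Rightarrow> 'a mat \<Rightarrow> 'a mat" where
  "append_cols A B = four_block_mat A B (0\<^sub>m 0 (dim_col A)) (0\<^sub>m 0 (dim_col B))"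

(* Meaningful for invertible A only: mat_inverse returns None otherwise. *)
definition mat_inv :: "'a::field mat \<Rightarrow> 'a mat" where
  "mat_inv A = the (mat_inverse A)"

definition P0_obj :: "real mat \<Rightarrow> real vec \<Rightarrow> real \<Rightarrow> real vec \<Rightarrow> real" where
  "P0_obj Phi y lam0 x = (l2_norm_vec (y - Phi *\<^sub>v x))\<^sup>2 + lam0 * real (l0_norm_vec x)"

definition P1_obj :: "real mat \<Rightarrow> real vec \<Rightarrow> real \<Rightarrow> real vec \<Rightarrow> real" where
  "P1_obj Phi y lam1 x = (l2_norm_vec (y - Phi *\<^sub>v x))\<^sup>2 + lam1 * l1_norm_vec x"

definition P0_solution :: "real mat \<Rightarrow> real vec \<Rightarrow> real \<Rightarrow> real vec \<Rightarrow> bool" where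
  "P0_solution Phi y lam0 x \<longleftrightarrow>
     is_arg_min (P0_obj Phi y lam0) (\<lambda>z. z \<in> carrier_vec (dim_col Phi)) x"

definition P1_solution :: "real mat \<Rightarrow> real vec \<Rightarrow> real \<Rightarrow> real vec \<Rightarrow> bool" where
  "P1_solution Phi y lam1 x \<longleftrightarrow>
     is_arg_min (P1_obj Phi y lam1) (\<lambda>z. z \<in> carrier_vec (dim_col Phi)) x"

definition P0_minimum :: "real mat \<Rightarrow> real vec \<Rightarrow> real \<Rightarrow> real \<Rightarrow> bool" where
  "P0_minimum Phi y lam0 v \<longleftrightarrow>
     (\<exists>x \<in> carrier_vec (dim_col Phi). P0_obj Phi y lam0 x = v) \<and>
     (\<forall>x \<in> carrier_vec (dim_col Phi). v \<le> P0_obj Phi y lam0 x)"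

definition type0_optimal :: "real mat \<Rightarrow> real vec \<Rightarrow> real \<Rightarrow> nat set \<Rightarrow> bool" where
  "type0_optimal Phi y lam0 I \<longleftrightarrow> (\<exists>x. P0_solution Phi y lam0 x \<and> supp_vec x = I)"

definition type1_optimal :: "real mat \<Rightarrow> real vec \<Rightarrow> real \<Rightarrow> nat set \<Rightarrow> bool" where
  "type1_optimal Phi y lam1 I \<longleftrightarrow> (\<exists>x. P1_solution Phi y lam1 x \<and> supp_vec x = I)"

definition concurrent_optimal ::
    "real mat \<Rightarrow> real vec \<Rightarrow> real \<Rightarrow> real \<Rightarrow> nat set \<Rightarrow> bool" where
  "concurrent_optimal Phi y lam0 lam1 I \<longleftrightarrow>
     type0_optimal Phi y lam0 I \<and> type1_optimal Phi y lam1 I"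

end

theory Submission
  imports Defs
begin

text \<open>
  Let \<open>c = \<Phi>\<^sup>T (y - \<Phi> x)\<close>. Moving a minimizer \<open>x\<close> of (P0) along a coordinate in its support does not
  increase the support, so only the quadratic term matters and \<open>c\<close> vanishes on the support: on
  \<open>I\<^sub>1\<close> the solution is the least-squares one. For (P1), whose objective is convex,
  coordinatewise perturbation gives the subgradient conditions \<open>c\<^sub>i = \<lambda>\<^sub>1/2 sign x\<^sub>i\<close> on the support
  and \<open>|c\<^sub>i| \<le> \<lambda>\<^sub>1/2\<close> off it, which are also sufficient; \<open>\<omega>\<close> is the part of \<open>c\<close> outside \<open>I\<^sub>1\<close>.
  Subtracting the two sets of normal equations on \<open>I\<^sub>1\<close> gives the formula for the difference.
\<close>

section \<open>Sign of the first-order term of a quadratic polynomial in one variable\<close>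

lemma linear_term_nonneg:
  fixes a b e :: real
  assumes "e > 0" and nonneg: "\<And>t. 0 < t \<Longrightarrow> t < e \<Longrightarrow> 0 \<le> t * a + t\<^sup>2 * b"
  shows "a \<ge> 0"
proof (rule ccontr)
  assume "\<not> a \<ge> 0"
  then have a: "a < 0" by simp
  \<comment> \<open>The second bound gives \<open>t * b \<le> - a / 2\<close>, so the quadratic term
    cannot outweigh the linear one; the summand 1 keeps the denominator positive when
    \<open>b = 0\<close>. The bound \<open>e / 2\<close> keeps \<open>t\<close> in the admissible
    interval.\<close>
  define t where "t = min (e / 2) (- a / (2 * (\<bar>b\<bar> + 1)))"
  have t: "0 < t" "t < e"
    unfolding t_def using \<open>e > 0\<close> a by (auto simp: min_less_iff_disj intro!: divide_neg_pos)
  have "t * b \<le> t * (\<bar>b\<bar> + 1)"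
    using t by (intro mult_left_mono) auto
  also have "\<dots> \<le> - a / (2 * (\<bar>b\<bar> + 1)) * (\<bar>b\<bar> + 1)"
    unfolding t_def by (intro mult_right_mono) auto
  also have "\<dots> = - a / 2"
    by (simp add: divide_simps)
  finally have "a + t * b < 0" using a by linarith
  then have "t * (a + t * b) < 0"
    using t by (simp add: mult_pos_neg)
  then show False
    using nonneg[OF t] by (simp add: power2_eq_square algebra_simps)
qed

lemma linear_term_zero:
  fixes a b e :: real
  assumes "e > 0" and nonneg: "\<And>t. \<bar>t\<bar> < e \<Longrightarrow> 0 \<le> t * a + t\<^sup>2 * b"
  shows "a = 0"
proof -
  have "a \<ge> 0"
    by (rule linear_term_nonneg[OF \<open>e > 0\<close>, of _ b]) (simp add: nonneg)
  \<comment> \<open>Replacing \<open>t\<close> by \<open>- t\<close> flips the linear term and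
    preserves the quadratic one.\<close>
  moreover have "- a \<ge> 0"
    by (rule linear_term_nonneg[OF \<open>e > 0\<close>, of _ b]) (use nonneg[of "- t" for t] in simp)
  ultimately show ?thesis by simp
qed

section \<open>Exact expansion of the residual and of the 1-norm under a displacement\<close>

lemma l2_norm_vec_square: "(l2_norm_vec v)\<^sup>2 = v \<bullet> v"
  unfolding l2_norm_vec_def L2_set_def scalar_prod_def
  by (simp add: sum_nonneg power2_eq_square atLeast0LessThan)

text \<open>Expanding the square leaves no remainder, and adjointness moves the linear term from
  \<open>A *\<^sub>v d\<close> to \<open>d\<close>. Its coefficient is the vector of inner products
  of the columns with the residual, in which all optimality conditions below are expressed.\<close>

lemma residual_shift:
  fixes A :: "real mat"
  assumes A: "A \<in> carrier_mat n m" and y: "y \<in> carrier_vec n"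
    and x: "x \<in> carrier_vec m" and d: "d \<in> carrier_vec m"
  shows "(l2_norm_vec (y - A *\<^sub>v (x + d)))\<^sup>2
    = (l2_norm_vec (y - A *\<^sub>v x))\<^sup>2 - 2 * ((transpose_mat A *\<^sub>v (y - A *\<^sub>v x)) \<bullet> d)
      + (A *\<^sub>v d) \<bullet> (A *\<^sub>v d)"
proof -
  define r where "r = y - A *\<^sub>v x"
  define w where "w = A *\<^sub>v d"
  have r: "r \<in> carrier_vec n" and w: "w \<in> carrier_vec n"
    using A y x d by (auto simp: r_def w_def)
  have "y - A *\<^sub>v (x + d) = r - w"
    using A y x d by (auto simp: r_def w_def mult_add_distrib_mat_vec[OF A x d])
  moreover have "(r - w) \<bullet> (r - w) = r \<bullet> r - 2 * (r \<bullet> w) + w \<bullet> w"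
    using r w comm_scalar_prod[OF r w]
    by (simp add: minus_scalar_prod_distrib[of _ n] scalar_prod_minus_distrib[of _ n])
  moreover have "(transpose_mat A *\<^sub>v r) \<bullet> d = r \<bullet> w"
    unfolding w_def using transpose_vec_mult_scalar[OF A d r] .
  ultimately show ?thesis
    unfolding l2_norm_vec_square r_def[symmetric] w_def[symmetric] by simp
qed

lemma residual_shift_unit:
  fixes A :: "real mat"
  assumes A: "A \<in> carrier_mat n m" and y: "y \<in> carrier_vec n"
    and x: "x \<in> carrier_vec m" and i: "i < m"
  shows "(l2_norm_vec (y - A *\<^sub>v (x + t \<cdot>\<^sub>v unit_vec m i)))\<^sup>2
    = (l2_norm_vec (y - A *\<^sub>v x))\<^sup>2 - 2 * t * (transpose_mat A *\<^sub>v (y - A *\<^sub>v x)) $ i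
      + t\<^sup>2 * ((A *\<^sub>v unit_vec m i) \<bullet> (A *\<^sub>v unit_vec m i))"
proof -
  let ?e = "unit_vec m i :: real vec"
  have c: "transpose_mat A *\<^sub>v (y - A *\<^sub>v x) \<in> carrier_vec m"
    using A y x by auto
  have "A *\<^sub>v (t \<cdot>\<^sub>v ?e) = t \<cdot>\<^sub>v (A *\<^sub>v ?e)"
    using mult_mat_vec[OF A] by simp
  then show ?thesis
    using residual_shift[OF A y x, of "t \<cdot>\<^sub>v ?e"] c i
    by (simp add: power2_eq_square scalar_prod_right_unit)
qed

lemma l1_norm_vec_shift_unit:
  assumes x: "x \<in> carrier_vec m" and i: "i < m"
  shows "l1_norm_vec (x + t \<cdot>\<^sub>v unit_vec m i) = l1_norm_vec x + \<bar>x $ i + t\<bar> - \<bar>x $ i\<bar>"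
proof -
  have "(\<Sum>j<m. \<bar>(x + t \<cdot>\<^sub>v unit_vec m i) $ j\<bar>)
      = \<bar>x $ i + t\<bar> + (\<Sum>j\<in>{..<m} - {i}. \<bar>(x + t \<cdot>\<^sub>v unit_vec m i) $ j\<bar>)"
    using x i by (subst sum.remove[of _ i]) auto
  also have "(\<Sum>j\<in>{..<m} - {i}. \<bar>(x + t \<cdot>\<^sub>v unit_vec m i) $ j\<bar>) = (\<Sum>j\<in>{..<m} - {i}. \<bar>x $ j\<bar>)"
    using x i by (intro sum.cong) auto
  also have "\<dots> = (\<Sum>j<m. \<bar>x $ j\<bar>) - \<bar>x $ i\<bar>"
    using i by (subst sum.remove[of "{..<m}" i]) auto
  finally show ?thesis using x by (simp add: l1_norm_vec_def)
qed

section \<open>First-order conditions for (P1) and (P0)\<close>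

lemma P1_solution_iff:
  fixes A :: "real mat"
  assumes A: "A \<in> carrier_mat n m" and y: "y \<in> carrier_vec n" and lam: "lam \<ge> 0"
  shows "P1_solution A y lam x \<longleftrightarrow> x \<in> carrier_vec m \<and>
    (\<forall>i<m. let c = (transpose_mat A *\<^sub>v (y - A *\<^sub>v x)) $ i
       in if x $ i = 0 then \<bar>c\<bar> \<le> lam / 2 else c = lam / 2 * sgn (x $ i))"
    (is "_ \<longleftrightarrow> _ \<and> ?kkt")
proof (cases "x \<in> carrier_vec m")
  case x: True
  define c where "c = transpose_mat A *\<^sub>v (y - A *\<^sub>v x)"
  have c: "c \<in> carrier_vec m" using A y x by (auto simp: c_def)
  have sol: "P1_solution A y lam x \<longleftrightarrow> (\<forall>z\<in>carrier_vec m. P1_obj A y lam x \<le> P1_obj A y lam z)"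
    using A x by (auto simp: P1_solution_def is_arg_min_def not_less)
  have "P1_solution A y lam x \<longleftrightarrow> ?kkt"
  proof
    assume "P1_solution A y lam x"
    then have min: "P1_obj A y lam x \<le> P1_obj A y lam z" if "z \<in> carrier_vec m" for z
      using sol that by blast
    show ?kkt
    proof (intro allI impI)
      fix i assume i: "i < m"
      define q where "q = (A *\<^sub>v unit_vec m i) \<bullet> (A *\<^sub>v unit_vec m i)"
      \<comment> \<open>Compares \<open>x\<close> with its shift by \<open>t\<close> along
        coordinate \<open>i\<close>: of the 1-norm, only the absolute value of entry
        \<open>i\<close> changes.\<close>
      have diff: "0 \<le> lam * (\<bar>x $ i + t\<bar> - \<bar>x $ i\<bar>) - 2 * t * c $ i + t\<^sup>2 * q" for t
        using min[of "x + t \<cdot>\<^sub>v unit_vec m i"] x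
        by (simp add: P1_obj_def residual_shift_unit[OF A y x i] l1_norm_vec_shift_unit[OF x i]
            c_def q_def algebra_simps)
      have "if x $ i = 0 then \<bar>c $ i\<bar> \<le> lam / 2 else c $ i = lam / 2 * sgn (x $ i)"
      proof (cases "x $ i = 0")
        case True
        \<comment> \<open>At a zero entry the penalty has a kink, so positive and negative shifts
          are treated apart and each yields one of the two bounds on \<open>c $ i\<close>.\<close>
        have "lam - 2 * c $ i \<ge> 0"
        proof (rule linear_term_nonneg[of 1 _ q])
          fix t :: real assume "0 < t"
          then show "0 \<le> t * (lam - 2 * c $ i) + t\<^sup>2 * q"
            using diff[of t] True by (simp add: algebra_simps)
        qed simp
        moreover have "lam + 2 * c $ i \<ge> 0"
        proof (rule linear_term_nonneg[of 1 _ q])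
          fix t :: real assume "0 < t"
          then show "0 \<le> t * (lam + 2 * c $ i) + t\<^sup>2 * q"
            using diff[of "- t"] True by (simp add: algebra_simps)
        qed simp
        ultimately show ?thesis using True by auto
      next
        case False
        have "lam * sgn (x $ i) - 2 * c $ i = 0"
        \<comment> \<open>Within radius \<open>\<bar>x $ i\<bar>\<close> the shifted entry does not
          change sign, so the absolute value is linear there and both directions are
          available.\<close>
        proof (rule linear_term_zero[of "\<bar>x $ i\<bar>" _ q])
          fix t :: real assume "\<bar>t\<bar> < \<bar>x $ i\<bar>"
          then have "\<bar>x $ i + t\<bar> - \<bar>x $ i\<bar> = sgn (x $ i) * t"
            by (auto simp: sgn_if abs_if split: if_splits)
          then show "0 \<le> t * (lam * sgn (x $ i) - 2 * c $ i) + t\<^sup>2 * q"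
            using diff[of t] by (simp add: algebra_simps)
        qed (use False in simp)
        then show ?thesis using False by simp
      qed
      then show "let c = (transpose_mat A *\<^sub>v (y - A *\<^sub>v x)) $ i
       in if x $ i = 0 then \<bar>c\<bar> \<le> lam / 2 else c = lam / 2 * sgn (x $ i)"
        unfolding c_def Let_def .
    qed
  next
    assume kkt: ?kkt
    have "P1_obj A y lam x \<le> P1_obj A y lam z" if z: "z \<in> carrier_vec m" for z
    proof -
      define d where "d = z - x"
      have d: "d \<in> carrier_vec m" and zd: "z = x + d"
        using x z by (auto simp: d_def)
      \<comment> \<open>The subgradient inequality of \<open>lam * \<bar>_\<bar>\<close> at
        \<open>x $ i\<close>, with slope \<open>2 * c $ i\<close>. Summed over all coordinates, it
        says that the growth of the penalty compensates the linear term of the residual; the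
        remaining quadratic term is a square.\<close>
      have subgrad: "2 * (c $ i * d $ i) \<le> lam * \<bar>z $ i\<bar> - lam * \<bar>x $ i\<bar>" if i: "i < m" for i
      proof (cases "x $ i = 0")
        case True
        then have "\<bar>2 * c $ i\<bar> \<le> lam" using kkt i by (auto simp: c_def Let_def)
        then have "\<bar>2 * c $ i\<bar> * \<bar>z $ i\<bar> \<le> lam * \<bar>z $ i\<bar>"
          by (rule mult_right_mono) simp
        moreover have "2 * c $ i * z $ i \<le> \<bar>2 * c $ i\<bar> * \<bar>z $ i\<bar>"
          by (metis abs_ge_self abs_mult)
        ultimately show ?thesis using True x z i by (simp add: d_def)
      next
        case False
        then have "2 * c $ i = lam * sgn (x $ i)" using kkt i by (auto simp: c_def Let_def)
        moreover have "2 * (c $ i * d $ i) = 2 * c $ i * (z $ i - x $ i)"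
          using x z i by (simp add: d_def)
        ultimately have "2 * (c $ i * d $ i) = lam * (sgn (x $ i) * z $ i) - lam * \<bar>x $ i\<bar>"
          by (simp add: algebra_simps abs_sgn)
        moreover have "sgn (x $ i) * z $ i \<le> \<bar>z $ i\<bar>"
          by (auto simp: sgn_if)
        ultimately show ?thesis using mult_left_mono[OF _ lam] by fastforce
      qed
      have "2 * (c \<bullet> d) = (\<Sum>i<m. 2 * (c $ i * d $ i))"
        using d by (simp add: scalar_prod_def sum_distrib_left atLeast0LessThan)
      also have "\<dots> \<le> (\<Sum>i<m. lam * \<bar>z $ i\<bar> - lam * \<bar>x $ i\<bar>)"
        using subgrad by (intro sum_mono) auto
      also have "\<dots> = lam * l1_norm_vec z - lam * l1_norm_vec x"
        using x z by (simp add: l1_norm_vec_def sum_subtractf sum_distrib_left)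
      finally have "2 * (c \<bullet> d) \<le> lam * l1_norm_vec z - lam * l1_norm_vec x" .
      moreover have "(A *\<^sub>v d) \<bullet> (A *\<^sub>v d) \<ge> 0"
        by (metis l2_norm_vec_square zero_le_power2)
      ultimately show ?thesis
        using residual_shift[OF A y x d] by (simp add: P1_obj_def zd c_def)
    qed
    then show "P1_solution A y lam x" using sol by blast
  qed
  then show ?thesis using x by simp
next
  case False
  then show ?thesis using A by (auto simp: P1_solution_def is_arg_min_def)
qed

lemma P0_solution_gradient:
  fixes A :: "real mat"
  assumes A: "A \<in> carrier_mat n m" and y: "y \<in> carrier_vec n" and lam: "lam \<ge> 0"
    and sol: "P0_solution A y lam x" and i: "i \<in> supp_vec x"
  shows "(transpose_mat A *\<^sub>v (y - A *\<^sub>v x)) $ i = 0"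
proof -
  have x: "x \<in> carrier_vec m" using sol A by (auto simp: P0_solution_def is_arg_min_def)
  have im: "i < m" using i x by (auto simp: supp_vec_def)
  define q where "q = (A *\<^sub>v unit_vec m i) \<bullet> (A *\<^sub>v unit_vec m i)"
  have "- 2 * (transpose_mat A *\<^sub>v (y - A *\<^sub>v x)) $ i = 0"
  proof (rule linear_term_zero[of 1 _ q])
    fix t :: real
    let ?z = "x + t \<cdot>\<^sub>v unit_vec m i"
    \<comment> \<open>The inclusion is strict when \<open>t\<close> cancels entry \<open>i\<close>,
      so the penalties are compared by an inequality and not by an equality.\<close>
    have "supp_vec ?z \<subseteq> supp_vec x"
      using i x by (auto simp: supp_vec_def split: if_splits)
    then have "l0_norm_vec ?z \<le> l0_norm_vec x"
      unfolding l0_norm_vec_def by (intro card_mono) (auto simp: supp_vec_def)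
    then have "lam * real (l0_norm_vec ?z) \<le> lam * real (l0_norm_vec x)"
      using lam by (intro mult_left_mono) auto
    moreover have "?z \<in> carrier_vec (dim_col A)"
      using A x by auto
    then have "P0_obj A y lam x \<le> P0_obj A y lam ?z"
      using sol by (auto simp: P0_solution_def is_arg_min_def not_less)
    ultimately show "0 \<le> t * (- 2 * (transpose_mat A *\<^sub>v (y - A *\<^sub>v x)) $ i) + t\<^sup>2 * q"
      by (simp add: P0_obj_def residual_shift_unit[OF A y x im] q_def)
  qed simp
  then show ?thesis by simp
qed

section \<open>Restriction of vectors and matrices to an index set\<close>

lemma bij_betw_pick:
  assumes "finite I"
  shows "bij_betw (pick I) {..<card I} I"
  unfolding bij_betw_def
proof
  \<comment> \<open>The inverse of \<open>pick I\<close> is the rank in \<open>I\<close>, that is,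
    the number of smaller elements of \<open>I\<close>.\<close>
  show "inj_on (pick I) {..<card I}"
    by (rule inj_on_inverseI[of _ "\<lambda>i. card {a \<in> I. a < i}"]) (simp add: card_pick)
  have "i \<in> pick I ` {..<card I}" if "i \<in> I" for i
  proof
    show "i = pick I (card {a \<in> I. a < i})" using that by (simp add: pick_card_in_set)
    show "card {a \<in> I. a < i} \<in> {..<card I}"
      using psubset_card_mono[OF assms, of "{a \<in> I. a < i}"] that by auto
  qed
  then show "pick I ` {..<card I} = I" by (auto simp: pick_in_set)
qed

lemma subvec_carrier:
  assumes "x \<in> carrier_vec m" and "I \<subseteq> {..<m}"
  shows "subvec x I \<in> carrier_vec (card I)"
proof -
  have "{i. i < m \<and> i \<in> I} = I" using assms(2) by blast
  then show ?thesis
    unfolding subvec_def carrier_vecD[OF assms(1)] by (simp only: vec_carrier)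
qed

lemma index_subvec:
  assumes "x \<in> carrier_vec m" and "I \<subseteq> {..<m}" and "i < card I"
  shows "subvec x I $ i = x $ pick I i"
proof -
  have "{i. i < m \<and> i \<in> I} = I" using assms(2) by blast
  then show ?thesis using assms by (simp add: subvec_def)
qed

text \<open>The optimality conditions use the original indices, the matrix equations the indices
  renumbered by \<open>pick I\<close>; this carries entrywise conditions from one to the
  other.\<close>

lemma all_subvec_iff:
  assumes x: "x \<in> carrier_vec m" and I: "I \<subseteq> {..<m}"
  shows "(\<forall>i<card I. P (subvec x I $ i)) \<longleftrightarrow> (\<forall>i\<in>I. P (x $ i))"
proof -
  have "finite I" using I finite_subset by blast
  then have img: "I = pick I ` {..<card I}"
    using bij_betw_pick bij_betw_imp_surj_on by blast
  have "(\<forall>i<card I. P (subvec x I $ i)) \<longleftrightarrow> (\<forall>i<card I. P (x $ pick I i))"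
    by (simp add: index_subvec[OF x I])
  also have "\<dots> \<longleftrightarrow> (\<forall>i\<in>I. P (x $ i))"
    by (subst (2) img) auto
  finally show ?thesis .
qed

text \<open>For \<open>x\<close> supported in \<open>I\<close>, having no zero entry on
  \<open>I\<close> therefore amounts to \<open>supp_vec x = I\<close>. This is how conditions (i)
  and (ii) encode the support.\<close>

lemma nowhere_zero_subvec_iff:
  assumes x: "x \<in> carrier_vec m" and I: "I \<subseteq> {..<m}"
  shows "nowhere_zero_vec (subvec x I) \<longleftrightarrow> I \<subseteq> supp_vec x"
  using all_subvec_iff[OF x I, of "\<lambda>a. a \<noteq> 0"] subvec_carrier[OF x I] x I
  by (auto simp: nowhere_zero_vec_def supp_vec_def)

lemma subvec_minus:
  assumes x: "x \<in> carrier_vec m" and z: "z \<in> carrier_vec m" and I: "I \<subseteq> {..<m}"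
  shows "subvec (x - z) I = subvec x I - subvec z I"
proof (rule eq_vecI)
  fix i assume "i < dim_vec (subvec x I - subvec z I)"
  then have i: "i < card I" using subvec_carrier[OF z I] by simp
  have "finite I" using I finite_subset by blast
  then have "pick I i < m" using pick_in_set[of i I] i I by auto
  then show "subvec (x - z) I $ i = (subvec x I - subvec z I) $ i"
    using i x z I subvec_carrier[OF z I] by (simp add: index_subvec[of _ m])
qed (use subvec_carrier[of "x - z" m I] subvec_carrier[OF z I] x z I in auto)

text \<open>Conditions (i) and (ii) supply vectors indexed by \<open>I\<close> alone; extension by
  zero makes them candidates for (P0) and (P1).\<close>

lemma ex_vec_with_subvec:
  assumes u: "u \<in> carrier_vec (card I)" and I: "I \<subseteq> {..<m}"
  obtains x :: "real vec" where "x \<in> carrier_vec m" "subvec x I = u" "supp_vec x \<subseteq> I"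
proof
  let ?x = "vec m (\<lambda>i. if i \<in> I then u $ card {a \<in> I. a < i} else 0)"
  show x: "?x \<in> carrier_vec m" by simp
  show "supp_vec ?x \<subseteq> I" by (auto simp: supp_vec_def split: if_splits)
  show "subvec ?x I = u"
  proof (rule eq_vecI)
    fix i assume "i < dim_vec u"
    then have i: "i < card I" using u by simp
    then have "pick I i \<in> I" by (simp add: pick_in_set)
    then show "subvec ?x I $ i = u $ i"
      using i I by (auto simp: index_subvec[OF x I] card_pick)
  qed (use subvec_carrier[OF x I] u in auto)
qed

lemma submatrix_cols_carrier:
  assumes "A \<in> carrier_mat n m" and "I \<subseteq> {..<m}"
  shows "submatrix A UNIV I \<in> carrier_mat n (card I)"
proof -
  have "{i. i < m \<and> i \<in> I} = I" using assms(2) by blast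
  then show ?thesis using assms by (intro carrier_matI) (simp_all add: dim_submatrix)
qed

lemma index_submatrix_cols:
  assumes "A \<in> carrier_mat n m" and "I \<subseteq> {..<m}" and "i < n" and "j < card I"
  shows "submatrix A UNIV I $$ (i, j) = A $$ (i, pick I j)"
proof -
  have "{i. i < m \<and> i \<in> I} = I" using assms(2) by blast
  then show ?thesis using assms by (simp add: submatrix_index pick_UNIV)
qed

lemma transpose_submatrix_mult_vec:
  fixes A :: "real mat"
  assumes A: "A \<in> carrier_mat n m" and I: "I \<subseteq> {..<m}" and r: "r \<in> carrier_vec n"
  shows "transpose_mat (submatrix A UNIV I) *\<^sub>v r = subvec (transpose_mat A *\<^sub>v r) I"
proof (rule eq_vecI)
  have c: "transpose_mat A *\<^sub>v r \<in> carrier_vec m" using A r by auto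
  note S = submatrix_cols_carrier[OF A I]
  show "dim_vec (transpose_mat (submatrix A UNIV I) *\<^sub>v r) = dim_vec (subvec (transpose_mat A *\<^sub>v r) I)"
    using S subvec_carrier[OF c I] by simp
  fix j assume "j < dim_vec (subvec (transpose_mat A *\<^sub>v r) I)"
  then have j: "j < card I" using subvec_carrier[OF c I] by simp
  then have "pick I j < m" using pick_in_set[of j I] I by auto
  then show "(transpose_mat (submatrix A UNIV I) *\<^sub>v r) $ j = subvec (transpose_mat A *\<^sub>v r) I $ j"
    using j S A r by (simp add: index_subvec[OF c I] scalar_prod_def index_submatrix_cols[OF A I])
qed

text \<open>Columns outside \<open>I\<close> meet only zero entries of \<open>x\<close>, so dropping
  both leaves the product unchanged.\<close>

lemma submatrix_mult_subvec:
  fixes A :: "real mat"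
  assumes A: "A \<in> carrier_mat n m" and I: "I \<subseteq> {..<m}" and x: "x \<in> carrier_vec m"
    and supp: "supp_vec x \<subseteq> I"
  shows "submatrix A UNIV I *\<^sub>v subvec x I = A *\<^sub>v x"
proof (rule eq_vecI)
  note S = submatrix_cols_carrier[OF A I]
  note u = subvec_carrier[OF x I]
  have fin: "finite I" using I finite_subset by blast
  show "dim_vec (submatrix A UNIV I *\<^sub>v subvec x I) = dim_vec (A *\<^sub>v x)"
    using S A by simp
  fix k assume "k < dim_vec (A *\<^sub>v x)"
  then have k: "k < n" using A by simp
  have "(submatrix A UNIV I *\<^sub>v subvec x I) $ k = (\<Sum>j<card I. A $$ (k, pick I j) * x $ pick I j)"
    using k S u by (simp add: scalar_prod_def index_submatrix_cols[OF A I] index_subvec[OF x I]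
        atLeast0LessThan)
  also have "\<dots> = (\<Sum>j\<in>I. A $$ (k, j) * x $ j)"
    using sum.reindex_bij_betw[OF bij_betw_pick[OF fin]] .
  also have "\<dots> = (\<Sum>j<m. A $$ (k, j) * x $ j)"
    using supp x I by (intro sum.mono_neutral_left) (auto simp: supp_vec_def)
  also have "\<dots> = (A *\<^sub>v x) $ k"
    using k A x by (simp add: scalar_prod_def atLeast0LessThan)
  finally show "(submatrix A UNIV I *\<^sub>v subvec x I) $ k = (A *\<^sub>v x) $ k" .
qed

section \<open>Column blocks, the sup norm, inverses and residuals\<close>

lemma transpose_append_cols_mult_vec:
  fixes A B :: "real mat"
  assumes A: "A \<in> carrier_mat n k" and B: "B \<in> carrier_mat n l" and y: "y \<in> carrier_vec n"
  shows "transpose_mat (append_cols A B) *\<^sub>v y = (transpose_mat A *\<^sub>v y) @\<^sub>v (transpose_mat B *\<^sub>v y)"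
proof -
  have "transpose_mat (append_cols A B) = transpose_mat A @\<^sub>r transpose_mat B"
    unfolding append_cols_def append_rows_def using A B
    by (subst transpose_four_block_mat[OF A B]) auto
  then show ?thesis
    using A B y by (simp add: mat_mult_append[of _ k n _ l])
qed

text \<open>The maximum ranges over a set containing 0, whence \<open>c \<ge> 0\<close>. The vector
  of dimension 0 is covered too; it occurs when \<open>I\<close> is the whole index set and no
  columns remain.\<close>

lemma linf_norm_vec_le_iff:
  assumes "c \<ge> 0"
  shows "linf_norm_vec v \<le> c \<longleftrightarrow> (\<forall>i<dim_vec v. \<bar>v $ i\<bar> \<le> c)"
proof -
  have "finite {\<bar>v $ i\<bar> | i. i < dim_vec v}" by simp
  then show ?thesis unfolding linf_norm_vec_def using assms by (subst Max_le_iff) auto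
qed

text \<open>Makes \<open>mat_inv\<close> a genuine inverse: an invertible matrix is a unit of the
  matrix ring, which excludes the result \<open>None\<close> of \<open>mat_inverse\<close>.\<close>

lemma mat_inv_inverse:
  fixes G :: "real mat"
  assumes inv: "invertible_mat G" and G: "G \<in> carrier_mat k k"
  shows "mat_inv G \<in> carrier_mat k k" and "G * mat_inv G = 1\<^sub>m k" and "mat_inv G * G = 1\<^sub>m k"
proof -
  obtain B where "inverts_mat G B" "inverts_mat B G"
    using inv by (auto simp: invertible_mat_def)
  then have GB: "G * B = 1\<^sub>m k" and BG: "B * G = 1\<^sub>m (dim_row B)"
    using G by (auto simp: inverts_mat_def)
  \<comment> \<open>\<open>inverts_mat\<close> does not fix the dimensions of \<open>B\<close>, so
    they are read off the two product equations.\<close>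
  have "dim_col B = k" using arg_cong[OF GB, of dim_col] by simp
  moreover have "dim_row B = k" using arg_cong[OF BG, of dim_col] G by simp
  ultimately have "G \<in> Units (ring_mat TYPE(real) k ())"
    using G GB BG by (auto simp: Units_def ring_mat_def)
  then obtain C where "mat_inverse G = Some C"
    using mat_inverse(1)[OF G, where b = "()"] by (cases "mat_inverse G") auto
  then show "mat_inv G \<in> carrier_mat k k" and "G * mat_inv G = 1\<^sub>m k" and "mat_inv G * G = 1\<^sub>m k"
    using mat_inverse(2)[OF G] by (auto simp: mat_inv_def)
qed

lemma mat_inv_mult_vec_iff:
  fixes G :: "real mat"
  assumes inv: "invertible_mat G" and G: "G \<in> carrier_mat k k"
    and u: "u \<in> carrier_vec k" and b: "b \<in> carrier_vec k"
  shows "u = mat_inv G *\<^sub>v b \<longleftrightarrow> G *\<^sub>v u = b"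
proof -
  note C = mat_inv_inverse[OF inv G]
  have "G *\<^sub>v (mat_inv G *\<^sub>v b) = b"
    using assoc_mult_mat_vec[OF G C(1) b] C(2) b by simp
  moreover have "mat_inv G *\<^sub>v (G *\<^sub>v u) = u"
    using assoc_mult_mat_vec[OF C(1) G u] C(3) u by simp
  ultimately show ?thesis by metis
qed

text \<open>The matrix \<open>B\<close> is kept general because the identity is applied both to the
  columns in \<open>I\<close> and to the remaining ones.\<close>

lemma transpose_submatrix_mult_residual:
  fixes A :: "real mat"
  assumes A: "A \<in> carrier_mat n m" and y: "y \<in> carrier_vec n" and I: "I \<subseteq> {..<m}"
    and B: "B \<in> carrier_mat n k"
    and x: "x \<in> carrier_vec m" and supp: "supp_vec x \<subseteq> I"
  shows "transpose_mat B *\<^sub>v (y - A *\<^sub>v x)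
    = transpose_mat B *\<^sub>v y - (transpose_mat B * submatrix A UNIV I) *\<^sub>v subvec x I"
proof -
  note S = submatrix_cols_carrier[OF A I]
  note u = subvec_carrier[OF x I]
  have "A *\<^sub>v x \<in> carrier_vec n" using A x by auto
  then show ?thesis
    using B y S u submatrix_mult_subvec[OF A I x supp]
      mult_minus_distrib_mat_vec[of "transpose_mat B" k n y "A *\<^sub>v x"]
      assoc_mult_mat_vec[of "transpose_mat B" k n "submatrix A UNIV I" "card I" "subvec x I"]
    by simp
qed

lemma eq_vec_iff_diff_zero:
  fixes v w :: "real vec"
  assumes "v \<in> carrier_vec k" and "w \<in> carrier_vec k"
  shows "v = w \<longleftrightarrow> (\<forall>i<k. (w - v) $ i = 0)"
  using assms by (auto simp: vec_eq_iff)

lemma eq_vec_add_iff: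
  fixes v w z :: "real vec"
  assumes "v \<in> carrier_vec k" and "w \<in> carrier_vec k" and "z \<in> carrier_vec k"
  shows "v = w + z \<longleftrightarrow> (\<forall>i<k. (v - w) $ i = z $ i)"
  using assms by (auto simp: vec_eq_iff algebra_simps)

section \<open>The least-squares vector on the index set and its objective value\<close>

lemma gradient_zero_iff:
  fixes A :: "real mat"
  assumes A: "A \<in> carrier_mat n m" and y: "y \<in> carrier_vec n" and I: "I \<subseteq> {..<m}"
    and S_def: "S = submatrix A UNIV I" and inv: "invertible_mat (transpose_mat S * S)"
    and x: "x \<in> carrier_vec m" and supp: "supp_vec x \<subseteq> I"
  shows "(\<forall>i\<in>I. (transpose_mat A *\<^sub>v (y - A *\<^sub>v x)) $ i = 0)
    \<longleftrightarrow> subvec x I = mat_inv (transpose_mat S * S) *\<^sub>v (transpose_mat S *\<^sub>v y)"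
proof -
  have S: "S \<in> carrier_mat n (card I)"
    unfolding S_def by (rule submatrix_cols_carrier[OF A I])
  note u = subvec_carrier[OF x I]
  define c where "c = transpose_mat A *\<^sub>v (y - A *\<^sub>v x)"
  have c: "c \<in> carrier_vec m" using A y x by (auto simp: c_def)
  have r: "y - A *\<^sub>v x \<in> carrier_vec n" using A y x by auto
  have G: "transpose_mat S * S \<in> carrier_mat (card I) (card I)"
    and b: "transpose_mat S *\<^sub>v y \<in> carrier_vec (card I)"
    using S y by auto
  \<comment> \<open>On \<open>I\<close>, the vector \<open>c\<close> is the defect of the normal
    equations, so its vanishing there means that \<open>subvec x I\<close> solves them.\<close>
  have cI: "subvec c I = transpose_mat S *\<^sub>v y - (transpose_mat S * S) *\<^sub>v subvec x I"
    unfolding c_def transpose_submatrix_mult_vec[OF A I r, symmetric]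
    using transpose_submatrix_mult_residual[OF A y I S x supp] by (simp add: S_def)
  have Gu: "(transpose_mat S * S) *\<^sub>v subvec x I \<in> carrier_vec (card I)"
    by (rule mult_mat_vec_carrier[OF G u])
  have "(transpose_mat S * S) *\<^sub>v subvec x I = transpose_mat S *\<^sub>v y
      \<longleftrightarrow> (\<forall>i<card I. subvec c I $ i = 0)"
    unfolding cI by (rule eq_vec_iff_diff_zero[OF Gu b])
  also have "\<dots> \<longleftrightarrow> (\<forall>i\<in>I. c $ i = 0)"
    by (rule all_subvec_iff[OF c I])
  finally show ?thesis
    using mat_inv_mult_vec_iff[OF inv G u b] unfolding c_def by blast
qed

text \<open>For every index, either the entry of \<open>x\<close> or that of the gradient vanishes,
  so the residual is orthogonal to the fit \<open>A *\<^sub>v x\<close>. Its squared norm is then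
  its inner product with \<open>y\<close>.\<close>

lemma residual_of_gradient_zero:
  fixes A :: "real mat"
  assumes A: "A \<in> carrier_mat n m" and y: "y \<in> carrier_vec n"
    and x: "x \<in> carrier_vec m"
    and zero: "\<And>i. i \<in> supp_vec x \<Longrightarrow> (transpose_mat A *\<^sub>v (y - A *\<^sub>v x)) $ i = 0"
  shows "(l2_norm_vec (y - A *\<^sub>v x))\<^sup>2 = y \<bullet> y - y \<bullet> (A *\<^sub>v x)"
proof -
  define r where "r = y - A *\<^sub>v x"
  have r: "r \<in> carrier_vec n" and Ax: "A *\<^sub>v x \<in> carrier_vec n"
    using A y x by (auto simp: r_def)
  have "r \<bullet> (A *\<^sub>v x) = (transpose_mat A *\<^sub>v r) \<bullet> x"
    using transpose_vec_mult_scalar[OF A x r] by simp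
  also have "\<dots> = 0"
    unfolding scalar_prod_def using zero x
    by (intro sum.neutral) (auto simp: supp_vec_def r_def)
  finally have "r \<bullet> (A *\<^sub>v x) = 0" .
  moreover have "r \<bullet> r = r \<bullet> y - r \<bullet> (A *\<^sub>v x)"
    by (subst (2) r_def) (rule scalar_prod_minus_distrib[OF r y Ax])
  moreover have "r \<bullet> y = y \<bullet> y - y \<bullet> (A *\<^sub>v x)"
    unfolding r_def using y Ax comm_scalar_prod[OF y Ax]
    by (simp add: minus_scalar_prod_distrib[of _ n])
  ultimately show ?thesis
    by (simp add: l2_norm_vec_square r_def)
qed

text \<open>The quadratic part of the value in (i) comes from the orthogonality just shown; the
  penalties agree since restriction to the support loses no nonzero entry.\<close>

lemma P0_obj_least_squares:
  fixes A :: "real mat"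
  assumes A: "A \<in> carrier_mat n m" and y: "y \<in> carrier_vec n" and I: "I \<subseteq> {..<m}"
    and S_def: "S = submatrix A UNIV I" and inv: "invertible_mat (transpose_mat S * S)"
    and x: "x \<in> carrier_vec m" and supp: "supp_vec x = I"
    and u: "subvec x I = mat_inv (transpose_mat S * S) *\<^sub>v (transpose_mat S *\<^sub>v y)"
  shows "P0_obj A y lam x
    = y \<bullet> y - y \<bullet> (S *\<^sub>v subvec x I) + lam * real (l0_norm_vec (subvec x I))"
proof -
  have "l0_norm_vec (subvec x I) = card I"
  proof -
    have "nowhere_zero_vec (subvec x I)"
      using nowhere_zero_subvec_iff[OF x I] supp by simp
    then have "supp_vec (subvec x I) = {..<card I}"
      using subvec_carrier[OF x I] by (auto simp: supp_vec_def nowhere_zero_vec_def)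
    then show ?thesis by (simp add: l0_norm_vec_def)
  qed
  moreover have "S *\<^sub>v subvec x I = A *\<^sub>v x"
    using submatrix_mult_subvec[OF A I x] supp by (simp add: S_def)
  moreover have "(l2_norm_vec (y - A *\<^sub>v x))\<^sup>2 = y \<bullet> y - y \<bullet> (A *\<^sub>v x)"
    using residual_of_gradient_zero[OF A y x] iffD2[OF gradient_zero_iff[OF A y I S_def inv x] u] supp
    by blast
  moreover have "l0_norm_vec x = card I"
    using supp by (simp add: l0_norm_vec_def)
  ultimately show ?thesis
    unfolding P0_obj_def by presburger
qed

lemma P0_solution_subvec:
  fixes A :: "real mat"
  assumes A: "A \<in> carrier_mat n m" and y: "y \<in> carrier_vec n" and lam: "lam \<ge> 0"
    and I: "I \<subseteq> {..<m}"
    and S_def: "S = submatrix A UNIV I" and inv: "invertible_mat (transpose_mat S * S)"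
    and sol: "P0_solution A y lam x" and supp: "supp_vec x = I"
  shows "subvec x I = mat_inv (transpose_mat S * S) *\<^sub>v (transpose_mat S *\<^sub>v y)"
proof -
  have "x \<in> carrier_vec m" using sol A by (auto simp: P0_solution_def is_arg_min_def)
  from gradient_zero_iff[OF A y I S_def inv this] show ?thesis
    using P0_solution_gradient[OF A y lam sol] supp by blast
qed

section \<open>Characterizations of type-0 and type-1 optimal subsets\<close>

lemma P0_solution_iff_minimum:
  assumes "A \<in> carrier_mat n m" and "x \<in> carrier_vec m"
  shows "P0_solution A y lam x \<longleftrightarrow> P0_minimum A y lam (P0_obj A y lam x)"
  using assms by (auto simp: P0_solution_def P0_minimum_def is_arg_min_def not_less)

lemma type0_optimal_iff:
  fixes A :: "real mat"
  assumes A: "A \<in> carrier_mat n m" and y: "y \<in> carrier_vec n" and lam: "lam \<ge> 0"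
    and I: "I \<subseteq> {..<m}"
    and S_def: "S = submatrix A UNIV I" and inv: "invertible_mat (transpose_mat S * S)"
    and u_def: "u = mat_inv (transpose_mat S * S) *\<^sub>v (transpose_mat S *\<^sub>v y)"
  shows "type0_optimal A y lam I \<longleftrightarrow>
    P0_minimum A y lam (y \<bullet> y - y \<bullet> (S *\<^sub>v u) + lam * real (l0_norm_vec u)) \<and> nowhere_zero_vec u"
    (is "_ \<longleftrightarrow> ?min \<and> _")
proof
  assume "type0_optimal A y lam I"
  then obtain x where sol: "P0_solution A y lam x" and supp: "supp_vec x = I"
    by (auto simp: type0_optimal_def)
  have x: "x \<in> carrier_vec m" using sol A by (auto simp: P0_solution_def is_arg_min_def)
  have u: "subvec x I = u"
    using P0_solution_subvec[OF A y lam I S_def inv sol supp] u_def by simp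
  have "?min"
    using P0_solution_iff_minimum[OF A x] sol
      P0_obj_least_squares[OF A y I S_def inv x supp u[unfolded u_def]] u by simp
  then show "?min \<and> nowhere_zero_vec u"
    using nowhere_zero_subvec_iff[OF x I] supp u by simp
next
  assume *: "?min \<and> nowhere_zero_vec u"
  have S: "S \<in> carrier_mat n (card I)"
    unfolding S_def by (rule submatrix_cols_carrier[OF A I])
  have "transpose_mat S * S \<in> carrier_mat (card I) (card I)" using S by auto
  from mat_inv_inverse(1)[OF inv this] have "u \<in> carrier_vec (card I)"
    unfolding u_def using S y by auto
  \<comment> \<open>A minimizer attaining the value in (i) could have another support. The extension
    of \<open>u\<close> by zero attains the same value, and its support is exactly \<open>I\<close>
    because \<open>u\<close> has no zero entry.\<close>
  then obtain x where x: "x \<in> carrier_vec m" and u: "subvec x I = u" and "supp_vec x \<subseteq> I"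
    using ex_vec_with_subvec[OF _ I] by blast
  then have supp: "supp_vec x = I"
    using * nowhere_zero_subvec_iff[OF x I] by auto
  have "P0_solution A y lam x"
    using P0_solution_iff_minimum[OF A x] *
      P0_obj_least_squares[OF A y I S_def inv x supp u[unfolded u_def]] u by simp
  then show "type0_optimal A y lam I"
    using supp by (auto simp: type0_optimal_def)
qed

text \<open>The first-order conditions split along the support: the equalities on \<open>I\<close>
  form the vector equation, and the inequalities on the complement form the sup norm bound.\<close>

lemma P1_solution_iff_subvec:
  fixes A :: "real mat"
  assumes A: "A \<in> carrier_mat n m" and y: "y \<in> carrier_vec n" and lam: "lam \<ge> 0"
    and I: "I \<subseteq> {..<m}"
    and S_def: "S = submatrix A UNIV I" and T_def: "T = submatrix A UNIV ({..<m} - I)"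
    and x: "x \<in> carrier_vec m" and supp: "supp_vec x = I"
  shows "P1_solution A y lam x \<longleftrightarrow>
    transpose_mat S *\<^sub>v y
      = (transpose_mat S * S) *\<^sub>v subvec x I + (lam / 2) \<cdot>\<^sub>v map_vec sgn (subvec x I) \<and>
    linf_norm_vec (transpose_mat T *\<^sub>v y - (transpose_mat T * S) *\<^sub>v subvec x I) \<le> lam / 2"
proof -
  have J: "{..<m} - I \<subseteq> {..<m}" by blast
  have S: "S \<in> carrier_mat n (card I)"
    unfolding S_def by (rule submatrix_cols_carrier[OF A I])
  have T: "T \<in> carrier_mat n (card ({..<m} - I))"
    unfolding T_def by (rule submatrix_cols_carrier[OF A J])
  note u = subvec_carrier[OF x I]
  define c where "c = transpose_mat A *\<^sub>v (y - A *\<^sub>v x)"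
  have r: "y - A *\<^sub>v x \<in> carrier_vec n" using A y x by auto
  have c: "c \<in> carrier_vec m" using A r by (auto simp: c_def)
  have cI: "subvec c I = transpose_mat S *\<^sub>v y - (transpose_mat S * S) *\<^sub>v subvec x I"
    unfolding c_def transpose_submatrix_mult_vec[OF A I r, symmetric]
    using transpose_submatrix_mult_residual[OF A y I S x] supp by (simp add: S_def)
  have cJ: "subvec c ({..<m} - I) = transpose_mat T *\<^sub>v y - (transpose_mat T * S) *\<^sub>v subvec x I"
    unfolding c_def transpose_submatrix_mult_vec[OF A J r, symmetric]
    using transpose_submatrix_mult_residual[OF A y I T x] supp by (simp add: S_def T_def)
  have fin: "finite I" using I finite_subset by blast
  have "P1_solution A y lam x \<longleftrightarrow>
      (\<forall>i\<in>I. c $ i = lam / 2 * sgn (x $ i)) \<and> (\<forall>i\<in>{..<m} - I. \<bar>c $ i\<bar> \<le> lam / 2)"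
    using P1_solution_iff[OF A y lam, of x] x supp I by (auto simp: c_def[symmetric] Let_def supp_vec_def)
  \<comment> \<open>The condition involves two vectors at once, so the renumbering goes directly
    through the bijection \<open>pick I\<close>.\<close>
  also have "(\<forall>i\<in>I. c $ i = lam / 2 * sgn (x $ i))
      \<longleftrightarrow> (\<forall>i<card I. subvec c I $ i = lam / 2 * sgn (subvec x I $ i))"
    by (subst (1) bij_betw_imp_surj_on[OF bij_betw_pick[OF fin], symmetric])
      (auto simp: index_subvec[OF c I] index_subvec[OF x I])
  also have "\<dots> \<longleftrightarrow> transpose_mat S *\<^sub>v y
      = (transpose_mat S * S) *\<^sub>v subvec x I + (lam / 2) \<cdot>\<^sub>v map_vec sgn (subvec x I)"
  proof -
    have "(transpose_mat S * S) *\<^sub>v subvec x I \<in> carrier_vec (card I)"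
      "transpose_mat S *\<^sub>v y \<in> carrier_vec (card I)"
      using S u y by auto
    from eq_vec_add_iff[OF this(2,1), of "(lam / 2) \<cdot>\<^sub>v map_vec sgn (subvec x I)"]
    show ?thesis unfolding cI using u by auto
  qed
  also have "(\<forall>i\<in>{..<m} - I. \<bar>c $ i\<bar> \<le> lam / 2)
      \<longleftrightarrow> linf_norm_vec (transpose_mat T *\<^sub>v y - (transpose_mat T * S) *\<^sub>v subvec x I) \<le> lam / 2"
    using lam carrier_vecD[OF subvec_carrier[OF c J]]
      linf_norm_vec_le_iff[of "lam / 2" "subvec c ({..<m} - I)"]
      all_subvec_iff[OF c J, of "\<lambda>a. \<bar>a\<bar> \<le> lam / 2"]
    unfolding cJ[symmetric] by simp
  finally show ?thesis .
qed

lemma type1_optimal_iff: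
  fixes A :: "real mat"
  assumes A: "A \<in> carrier_mat n m" and y: "y \<in> carrier_vec n" and lam: "lam \<ge> 0"
    and I: "I \<subseteq> {..<m}"
    and S_def: "S = submatrix A UNIV I" and T_def: "T = submatrix A UNIV ({..<m} - I)"
  shows "type1_optimal A y lam I \<longleftrightarrow>
    (\<exists>u \<in> carrier_vec (card I). \<exists>\<omega> \<in> carrier_vec (m - card I).
       nowhere_zero_vec u \<and>
       transpose_mat (append_cols S T) *\<^sub>v y
         = ((transpose_mat S * S) @\<^sub>r (transpose_mat T * S)) *\<^sub>v u
           + (((lam / 2) \<cdot>\<^sub>v map_vec sgn u) @\<^sub>v \<omega>) \<and>
       linf_norm_vec \<omega> \<le> lam / 2)"
    (is "_ \<longleftrightarrow> ?R")
proof -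
  have S: "S \<in> carrier_mat n (card I)"
    unfolding S_def by (rule submatrix_cols_carrier[OF A I])
  have "card ({..<m} - I) = m - card I"
    using I by (subst card_Diff_subset) (auto intro: finite_subset)
  then have T: "T \<in> carrier_mat n (m - card I)"
    unfolding T_def using submatrix_cols_carrier[OF A, of "{..<m} - I"] by auto
  \<comment> \<open>The lower block determines \<open>\<omega>\<close> from \<open>u\<close>: it is
    the vector of inner products of the remaining columns with the residual. The existential over
    \<open>\<omega>\<close> thus reduces to a bound on this vector.\<close>
  have split: "transpose_mat (append_cols S T) *\<^sub>v y
         = ((transpose_mat S * S) @\<^sub>r (transpose_mat T * S)) *\<^sub>v u
           + (((lam / 2) \<cdot>\<^sub>v map_vec sgn u) @\<^sub>v \<omega>)
      \<longleftrightarrow> transpose_mat S *\<^sub>v y = (transpose_mat S * S) *\<^sub>v u + (lam / 2) \<cdot>\<^sub>v map_vec sgn u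
        \<and> \<omega> = transpose_mat T *\<^sub>v y - (transpose_mat T * S) *\<^sub>v u"
    if u: "u \<in> carrier_vec (card I)" and w: "\<omega> \<in> carrier_vec (m - card I)" for u \<omega>
  proof -
    have carr: "transpose_mat S * S \<in> carrier_mat (card I) (card I)"
      "transpose_mat T * S \<in> carrier_mat (m - card I) (card I)"
      using S T by auto
    have Gu: "(transpose_mat S * S) *\<^sub>v u \<in> carrier_vec (card I)"
      and Hu: "(transpose_mat T * S) *\<^sub>v u \<in> carrier_vec (m - card I)"
      and Sy: "transpose_mat S *\<^sub>v y \<in> carrier_vec (card I)"
      and Ty: "transpose_mat T *\<^sub>v y \<in> carrier_vec (m - card I)"
      and sg: "(lam / 2) \<cdot>\<^sub>v map_vec sgn u \<in> carrier_vec (card I)"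
      using carr S T y u by (auto intro!: mult_mat_vec_carrier)
    have "transpose_mat T *\<^sub>v y = (transpose_mat T * S) *\<^sub>v u + \<omega>
        \<longleftrightarrow> \<omega> = transpose_mat T *\<^sub>v y - (transpose_mat T * S) *\<^sub>v u"
      using Hu Ty w by (auto simp: vec_eq_iff)
    then show ?thesis
      unfolding transpose_append_cols_mult_vec[OF S T y] mat_mult_append[OF carr u]
        append_vec_add[OF Gu sg Hu w]
      using append_vec_eq[OF Sy, of "(transpose_mat S * S) *\<^sub>v u + (lam / 2) \<cdot>\<^sub>v map_vec sgn u"]
        Gu sg by auto
  qed
  show ?thesis
  proof
    assume "type1_optimal A y lam I"
    then obtain x where sol: "P1_solution A y lam x" and supp: "supp_vec x = I"
      by (auto simp: type1_optimal_def)
    have x: "x \<in> carrier_vec m" using sol A by (auto simp: P1_solution_def is_arg_min_def)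
    note u = subvec_carrier[OF x I]
    let ?w = "transpose_mat T *\<^sub>v y - (transpose_mat T * S) *\<^sub>v subvec x I"
    have w: "?w \<in> carrier_vec (m - card I)" using S T y u by (auto intro!: minus_carrier_vec)
    have "nowhere_zero_vec (subvec x I)"
      using nowhere_zero_subvec_iff[OF x I] supp by simp
    then show ?R
      using P1_solution_iff_subvec[OF A y lam I S_def T_def x supp] sol u w split[OF u w]
      by blast
  next
    assume ?R
    then obtain u \<omega> where u: "u \<in> carrier_vec (card I)" and w: "\<omega> \<in> carrier_vec (m - card I)"
      and nz: "nowhere_zero_vec u" and le: "linf_norm_vec \<omega> \<le> lam / 2"
      and eqs: "transpose_mat S *\<^sub>v y = (transpose_mat S * S) *\<^sub>v u + (lam / 2) \<cdot>\<^sub>v map_vec sgn u"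
        "\<omega> = transpose_mat T *\<^sub>v y - (transpose_mat T * S) *\<^sub>v u"
      using split by blast
    obtain x where x: "x \<in> carrier_vec m" and xu: "subvec x I = u" and "supp_vec x \<subseteq> I"
      using ex_vec_with_subvec[OF u I] by blast
    then have supp: "supp_vec x = I"
      using nz nowhere_zero_subvec_iff[OF x I] by auto
    have "P1_solution A y lam x"
      using P1_solution_iff_subvec[OF A y lam I S_def T_def x supp] xu eqs le by simp
    then show "type1_optimal A y lam I"
      using supp by (auto simp: type1_optimal_def)
  qed
qed

section \<open>The difference of the two solutions and the final equivalence\<close>

lemma P0_P1_solution_difference:
  fixes A :: "real mat"
  assumes A: "A \<in> carrier_mat n m" and y: "y \<in> carrier_vec n"
    and lam0: "lam0 \<ge> 0" and lam1: "lam1 \<ge> 0" and I: "I \<subseteq> {..<m}"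
    and S_def: "S = submatrix A UNIV I" and inv: "invertible_mat (transpose_mat S * S)"
    and sol0: "P0_solution A y lam0 x0" and supp0: "supp_vec x0 = I"
    and sol1: "P1_solution A y lam1 x1" and supp1: "supp_vec x1 = I"
  shows "subvec (x0 - x1) I
    = mat_inv (transpose_mat S * S) *\<^sub>v ((lam1 / 2) \<cdot>\<^sub>v map_vec sgn (subvec x1 I))"
proof -
  have x0: "x0 \<in> carrier_vec m" and x1: "x1 \<in> carrier_vec m"
    using sol0 sol1 A by (auto simp: P0_solution_def P1_solution_def is_arg_min_def)
  have S: "S \<in> carrier_mat n (card I)"
    unfolding S_def by (rule submatrix_cols_carrier[OF A I])
  define G where "G = transpose_mat S * S"
  have G: "G \<in> carrier_mat (card I) (card I)" and b: "transpose_mat S *\<^sub>v y \<in> carrier_vec (card I)"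
    using S y by (auto simp: G_def)
  note u0 = subvec_carrier[OF x0 I] and u1 = subvec_carrier[OF x1 I]
  let ?s = "(lam1 / 2) \<cdot>\<^sub>v map_vec sgn (subvec x1 I)"
  have s: "?s \<in> carrier_vec (card I)" using u1 by simp
  have Gu0: "G *\<^sub>v subvec x0 I = transpose_mat S *\<^sub>v y"
    using P0_solution_subvec[OF A y lam0 I S_def inv sol0 supp0]
      mat_inv_mult_vec_iff[OF inv[folded G_def] G u0 b] by (simp add: G_def)
  moreover have Gu1: "transpose_mat S *\<^sub>v y = G *\<^sub>v subvec x1 I + ?s"
    using P1_solution_iff_subvec[OF A y lam1 I S_def refl x1 supp1] sol1 by (simp add: G_def)
  moreover have "G *\<^sub>v subvec x1 I \<in> carrier_vec (card I)" using G u1 by auto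
  \<comment> \<open>Both systems contain the same vector \<open>transpose_mat S *\<^sub>v y\<close>,
    which cancels and leaves the sign term alone.\<close>
  ultimately have "G *\<^sub>v (subvec x0 I - subvec x1 I) = ?s"
    using s by (auto simp: mult_minus_distrib_mat_vec[OF G u0 u1] vec_eq_iff)
  then show ?thesis
    using mat_inv_mult_vec_iff[OF inv[folded G_def] G _ s, of "subvec x0 I - subvec x1 I"] u0 u1
    by (simp add: G_def subvec_minus[OF x0 x1 I])
qed

theorem corollary4p3:
  fixes Phi Phi1 Phi2 :: "real mat" and y :: "real vec"
    and lam0 lam1 :: real and n m :: nat and I1 :: "nat set"
  assumes "n > m"
    and "Phi \<in> carrier_mat n m"
    and "y \<in> carrier_vec n"
    and "lam0 \<ge> 0" and "lam1 \<ge> 0"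
    and "I1 \<subseteq> {..<m}"
    and "Phi1 = submatrix Phi UNIV I1"
    and "Phi2 = submatrix Phi UNIV ({..<m} - I1)"
    and "invertible_mat (transpose_mat Phi1 * Phi1)"
  shows
    "(concurrent_optimal Phi y lam0 lam1 I1 \<longleftrightarrow>
        (let x1 = mat_inv (transpose_mat Phi1 * Phi1) *\<^sub>v (transpose_mat Phi1 *\<^sub>v y)
         in P0_minimum Phi y lam0
              (y \<bullet> y
               - y \<bullet> (Phi1 *\<^sub>v (mat_inv (transpose_mat Phi1 * Phi1) *\<^sub>v (transpose_mat Phi1 *\<^sub>v y)))
               + lam0 * real (l0_norm_vec x1))
            \<and> nowhere_zero_vec x1)
        \<and>
        (\<exists>x1 \<in> carrier_vec (card I1). \<exists>\<omega> \<in> carrier_vec (m - card I1).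
           nowhere_zero_vec x1 \<and>
           transpose_mat (append_cols Phi1 Phi2) *\<^sub>v y
             = ((transpose_mat Phi1 * Phi1) @\<^sub>r (transpose_mat Phi2 * Phi1)) *\<^sub>v x1
               + (((lam1 / 2) \<cdot>\<^sub>v map_vec sgn x1) @\<^sub>v \<omega>) \<and>
           linf_norm_vec \<omega> \<le> lam1 / 2))
     \<and>
     (concurrent_optimal Phi y lam0 lam1 I1 \<longrightarrow>
        (\<forall>x0 x1. P0_solution Phi y lam0 x0 \<and> supp_vec x0 = I1 \<and>
                 P1_solution Phi y lam1 x1 \<and> supp_vec x1 = I1 \<longrightarrow>
           subvec (x0 - x1) I1
             = mat_inv (transpose_mat Phi1 * Phi1)
                 *\<^sub>v ((lam1 / 2) \<cdot>\<^sub>v map_vec sgn (subvec x1 I1))))"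
proof -
  \<comment> \<open>Here \<open>refl\<close> chooses for \<open>u\<close> the closed-form
    least-squares vector, the \<open>x1\<close> of (i). The \<open>x1\<close> of (ii) comes from
    (P1) and is in general a different vector; the difference formula relates the two.\<close>
  note type0 = type0_optimal_iff[OF assms(2,3,4,6,7,9) refl]
  note type1 = type1_optimal_iff[OF assms(2,3,5,6,7,8)]
  note difference = P0_P1_solution_difference[OF assms(2,3,4,5,6,7,9)]
  show ?thesis
    unfolding concurrent_optimal_def type0 type1 Let_def using difference by blast
qed

end
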